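(* Let $n\ge 1$ and let $\mu$ be a distribution with $\mu\{x\le 0\}\le n$ and $\mu\{x>0\}=0$. If a distribution $\nu$ is obtained from $\mu$ by a weight-constrained sequence of moves, then $\nu\{x\ge 6n^{1/3}-1\}=0$.
   Context: A (discrete mass) distribution is a finite set $\mu=\{(x_1,m_1),\dots,(x_k,m_k)\}$ with $x_i\in\mathbb R$ and $m_i>0$; a signed distribution is the same without the positivity requirement. For $A\subseteq\mathbb R$, $\mu(A)=\sum_{x_i\in A}m_i$, and $\mu\{x>a\}$ means $\mu(\{x:x>a\})$, etc. Moments: $M_j[\mu]=\sum_i m_ix_i^j$. A move $v=([a,b],\delta)$ consists of an interval with $b-a=1$ and a signed distribution $\delta$ supported in $[a,b]$ with $M_0[\delta]=M_1[\delta]=0$; its center is $\frac{a+b}2$. It can be applied to $\mu$ if $\mu+\delta$ (pointwise sum of masses) is a distribution, and then $v\mu=\mu+\delta$. A sequence of moves $v_1,\dots,v_\ell$ applied to $\mu_0$ produces $\mu_i=v_i\mu_{i-1}$. For such a sequence, $\mu_{\max}\{x>a\}=\max_{0\le i\le\ell}\mu_i\{x>a\}$ (similarly for $\ge$). The sequence is weight-constrained (with respect to $\mu_0$) if for every $a\in\mathbb R$ the number of moves of the sequence whose center lies in $(a,\infty)$ is at most $\mu_{\max}\{x>a\}$. *)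

theory Defs
  imports Complex_Main
begin

text \<open>A (signed) distribution is represented by its mass function \<open>real \<Rightarrow> real\<close>
  with finite support: the point x carries mass \<open>\<mu> x\<close>, and the finite set of
  pairs (x_i, m_i) is the graph of \<open>\<mu>\<close> restricted to its support.\<close>

definition supp :: "(real \<Rightarrow> real) \<Rightarrow> real set" where
  "supp \<mu> = {x. \<mu> x \<noteq> 0}"

definition signed_distribution :: "(real \<Rightarrow> real) \<Rightarrow> bool" where
  "signed_distribution \<mu> \<longleftrightarrow> finite (supp \<mu>)"

definition distribution :: "(real \<Rightarrow> real) \<Rightarrow> bool" where
  "distribution \<mu> \<longleftrightarrow> finite (supp \<mu>) \<and> (\<forall>x. \<mu> x \<ge> 0)"

definition mass :: "(real \<Rightarrow> real) \<Rightarrow> real set \<Rightarrow> real" where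
  "mass \<mu> A = (\<Sum>x\<in>supp \<mu> \<inter> A. \<mu> x)"

definition moment :: "nat \<Rightarrow> (real \<Rightarrow> real) \<Rightarrow> real" where
  "moment j \<mu> = (\<Sum>x\<in>supp \<mu>. \<mu> x * x ^ j)"

text \<open>A move \<open>(a, \<delta>)\<close> stands for the interval \<open>[a, a+1]\<close> together with \<open>\<delta>\<close>.\<close>
type_synonym move = "real \<times> (real \<Rightarrow> real)"

definition is_move :: "move \<Rightarrow> bool" where
  "is_move v \<longleftrightarrow> signed_distribution (snd v) \<and> supp (snd v) \<subseteq> {fst v .. fst v + 1}
     \<and> moment 0 (snd v) = 0 \<and> moment 1 (snd v) = 0"

definition center :: "move \<Rightarrow> real" where
  "center v = fst v + 1/2"

definition apply_move :: "move \<Rightarrow> (real \<Rightarrow> real) \<Rightarrow> (real \<Rightarrow> real)" where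
  "apply_move v \<mu> = (\<lambda>x. \<mu> x + snd v x)"

fun states :: "(real \<Rightarrow> real) \<Rightarrow> move list \<Rightarrow> (real \<Rightarrow> real) list" where
  "states \<mu> [] = [\<mu>]"
| "states \<mu> (v # vs) = \<mu> # states (apply_move v \<mu>) vs"

definition valid_sequence :: "(real \<Rightarrow> real) \<Rightarrow> move list \<Rightarrow> bool" where
  "valid_sequence \<mu> vs \<longleftrightarrow> (\<forall>v\<in>set vs. is_move v) \<and> (\<forall>\<nu>\<in>set (states \<mu> vs). distribution \<nu>)"

definition mu_max :: "(real \<Rightarrow> real) \<Rightarrow> move list \<Rightarrow> real set \<Rightarrow> real" where
  "mu_max \<mu> vs A = Max ((\<lambda>\<nu>. mass \<nu> A) ` set (states \<mu> vs))"

text \<open>Moves are counted with multiplicity (as entries of the sequence).\<close>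
definition weight_constrained :: "(real \<Rightarrow> real) \<Rightarrow> move list \<Rightarrow> bool" where
  "weight_constrained \<mu> vs \<longleftrightarrow>
     (\<forall>a::real. real (length (filter (\<lambda>v. center v > a) vs)) \<le> mu_max \<mu> vs {x. x > a})"

definition obtained_wc :: "(real \<Rightarrow> real) \<Rightarrow> (real \<Rightarrow> real) \<Rightarrow> bool" where
  "obtained_wc \<mu> \<nu> \<longleftrightarrow> (\<exists>vs. valid_sequence \<mu> vs \<and> weight_constrained \<mu> vs
      \<and> last (states \<mu> vs) = \<nu>)"

end

theory Submission
  imports Defs "HOL-Analysis.Analysis"
begin

text \<open>
  Fix \<open>r \<ge> 0\<close> and let \<open>m\<close> bound the mass that is ever beyond \<open>r\<close>. Put mass \<open>2m\<close> at \<open>c = r + 1/2\<close>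
  and let an auxiliary distribution \<open>\<rho>\<close> evolve by extreme moves (sweeps), which push all mass of a unit
  interval to its endpoints and so replace the convex potential \<open>1/2 \<Sum>y. \<rho> y |x - y|\<close> by its chord there.
  Two sweeps, one for the move and one for its mirror image about \<open>c\<close>, keep the potential of \<open>\<rho>\<close> above
  the (tilted and reflected) function \<open>x \<mapsto> \<Sum>y. \<nu> y max (y - x) 0\<close> of the true distribution \<open>\<nu>\<close> after a move
  with center beyond \<open>r\<close>; moves with center at most \<open>r\<close> cost nothing, as they do not reach beyond \<open>c\<close>.

  A sweep that raises the second moment by \<open>h\<close> raises the energy \<open>1/2 \<Sum>x y. \<rho> x \<rho> y |x - y|\<close> by at least
  \<open>3 h^2\<close>, whereas the energy is at most \<open>(2m)^(3/2)\<close> times the square root of the second moment \<open>V\<close>. Hence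
  \<open>N\<close> sweeps give \<open>9 V^3 \<le> N^2 (2m)^3\<close>. The weight constraint allows \<open>N \<le> 2m\<close>, so at most \<open>m/8\<close> can ever
  get beyond \<open>c + 5/2 m^(1/3)\<close>. Iterating over \<open>m, m/8, m/64, ...\<close> yields a geometric series, which stops
  as soon as the mass bound is below 1, since then no move is allowed.
\<close>

section \<open>Integration against finitely supported functions\<close>

definition integ :: "(real \<Rightarrow> real) \<Rightarrow> (real \<Rightarrow> real) \<Rightarrow> real" where
  "integ \<rho> g = (\<Sum>x\<in>supp \<rho>. \<rho> x * g x)"

lemma integ_superset:
  assumes "finite B" "supp \<rho> \<subseteq> B"
  shows "integ \<rho> g = (\<Sum>x\<in>B. \<rho> x * g x)"
  unfolding integ_def by (rule sum.mono_neutral_left) (use assms in \<open>auto simp: supp_def\<close>)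

lemma integ_add: "integ \<rho> (\<lambda>x. f x + g x) = integ \<rho> f + integ \<rho> g"
  by (simp add: integ_def sum.distrib algebra_simps)

lemma integ_diff: "integ \<rho> (\<lambda>x. f x - g x) = integ \<rho> f - integ \<rho> g"
  by (simp add: integ_def sum_subtractf algebra_simps)

lemma integ_cmult: "integ \<rho> (\<lambda>x. k * f x) = k * integ \<rho> f"
  by (simp add: integ_def sum_distrib_left algebra_simps)

lemma integ_measure_add:
  assumes "finite (supp \<rho>)" "finite (supp \<sigma>)"
  shows "integ (\<lambda>x. \<rho> x + \<sigma> x) g = integ \<rho> g + integ \<sigma> g"
proof -
  let ?B = "supp \<rho> \<union> supp \<sigma>"
  have "integ (\<lambda>x. \<rho> x + \<sigma> x) g = (\<Sum>x\<in>?B. (\<rho> x + \<sigma> x) * g x)"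
    by (rule integ_superset) (use assms in \<open>auto simp: supp_def\<close>)
  also have "\<dots> = (\<Sum>x\<in>?B. \<rho> x * g x) + (\<Sum>x\<in>?B. \<sigma> x * g x)"
    by (simp add: sum.distrib algebra_simps)
  finally show ?thesis
    using integ_superset[of ?B \<rho> g] integ_superset[of ?B \<sigma> g] assms by simp
qed

lemma integ_measure_diff:
  assumes "finite (supp \<rho>)" "finite (supp \<sigma>)"
  shows "integ (\<lambda>x. \<rho> x - \<sigma> x) g = integ \<rho> g - integ \<sigma> g"
proof -
  let ?B = "supp \<rho> \<union> supp \<sigma>"
  have "integ (\<lambda>x. \<rho> x - \<sigma> x) g = (\<Sum>x\<in>?B. (\<rho> x - \<sigma> x) * g x)"
    by (rule integ_superset) (use assms in \<open>auto simp: supp_def\<close>)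
  also have "\<dots> = (\<Sum>x\<in>?B. \<rho> x * g x) - (\<Sum>x\<in>?B. \<sigma> x * g x)"
    by (simp add: sum_subtractf algebra_simps)
  finally show ?thesis
    using integ_superset[of ?B \<rho> g] integ_superset[of ?B \<sigma> g] assms by simp
qed

lemma integ_mono:
  assumes "distribution \<rho>" "\<And>x. f x \<le> g x"
  shows "integ \<rho> f \<le> integ \<rho> g"
  unfolding integ_def
  by (rule sum_mono) (use assms in \<open>auto simp: distribution_def intro: mult_left_mono\<close>)

lemma integ_nonneg:
  assumes "distribution \<rho>" "\<And>x. 0 \<le> f x"
  shows "0 \<le> integ \<rho> f"
  unfolding integ_def
  by (rule sum_nonneg) (use assms in \<open>auto simp: distribution_def\<close>)

lemma mass_eq_integ: "finite (supp \<rho>) \<Longrightarrow> mass \<rho> A = integ \<rho> (indicator A)"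
  by (auto simp: mass_def integ_def indicator_def sum.inter_restrict if_distrib cong: if_cong)

lemma mass_mono: "distribution \<rho> \<Longrightarrow> A \<subseteq> B \<Longrightarrow> mass \<rho> A \<le> mass \<rho> B"
  by (auto simp: mass_eq_integ distribution_def indicator_def intro!: integ_mono)

lemma moment_eq_integ: "moment j \<rho> = integ \<rho> (\<lambda>x. x ^ j)"
  by (simp add: moment_def integ_def)

text \<open>Cauchy--Schwarz on \<open>[a, a+1]\<close> between \<open>t - (a + 1/2)\<close> and the distribution function
  \<open>t \<mapsto> \<Sum>y\<le>t. d y\<close>, whose squared norm is the right-hand side.\<close>
lemma second_moment_le_energy:
  fixes d :: "real \<Rightarrow> real"
  assumes fin: "finite B" and sub: "B \<subseteq> {a..a+1}"
    and d0: "(\<Sum>y\<in>B. d y) = 0" and d1: "(\<Sum>y\<in>B. d y * y) = 0"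
  shows "3 * (\<Sum>y\<in>B. d y * y\<^sup>2)\<^sup>2 \<le> - (\<Sum>y\<in>B. \<Sum>z\<in>B. d y * d z * \<bar>y - z\<bar>) / 2"
proof -
  define h where "h = (\<Sum>y\<in>B. d y * y\<^sup>2)"
  define Q where "Q = - (\<Sum>y\<in>B. \<Sum>z\<in>B. d y * d z * \<bar>y - z\<bar>) / 2"
  define c where "c = a + 1/2"
  \<comment> \<open>With \<open>D\<close> the distribution function of \<open>d\<close>, the
    integral of \<open>(D - l * (t - c))^2\<close> is \<open>Q + l * h + l^2 / 12\<close>, which is
    smallest at this \<open>l\<close>.\<close>
  define l where "l = - 6 * h"
  define s :: "real \<Rightarrow> real \<Rightarrow> real" where "s y t = (if y \<le> t then 1 else 0)" for y t
  have i1: "((\<lambda>t. s y t * s z t) has_integral (a + 1 - max y z)) {a..a+1}"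
    if "y \<in> B" "z \<in> B" for y z
  proof -
    have le: "a \<le> max y z" "max y z \<le> a + 1" using that sub by (auto simp: max_def)
    have "((\<lambda>t. 1::real) has_integral (a + 1 - max y z)) {max y z..a+1}"
      using has_integral_const_real[of "1::real" "max y z" "a+1"] le by simp
    then have "((\<lambda>t. if t \<in> {max y z..a+1} then 1 else 0 :: real) has_integral (a + 1 - max y z)) {a..a+1}"
      using le by (subst has_integral_restrict) auto
    then show ?thesis
      by (rule has_integral_eq[rotated]) (auto simp: s_def)
  qed
  have i2: "((\<lambda>t. s y t * (t - c)) has_integral ((1/4 - (y - c)\<^sup>2) / 2)) {a..a+1}"
    if "y \<in> B" for y
  proof -
    have le: "a \<le> y" "y \<le> a + 1" using that sub by auto
    have "((\<lambda>t. t - c) has_integral ((a + 1 - c)\<^sup>2 / 2 - (y - c)\<^sup>2 / 2)) {y..a+1}"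
      by (rule fundamental_theorem_of_calculus[OF le(2)])
        (auto intro!: derivative_eq_intros simp flip: has_real_derivative_iff_has_vector_derivative)
    then have "((\<lambda>t. if t \<in> {y..a+1} then t - c else 0) has_integral ((1/4 - (y - c)\<^sup>2) / 2)) {a..a+1}"
      using le by (subst has_integral_restrict) (auto simp: c_def power2_eq_square field_simps)
    then show ?thesis
      by (rule has_integral_eq[rotated]) (auto simp: s_def)
  qed
  have i3: "((\<lambda>t. (t - c)\<^sup>2) has_integral (1/12)) {a..a+1}"
  proof -
    have "((\<lambda>t. (t - c)\<^sup>2) has_integral ((a + 1 - c)^3 / 3 - (a - c)^3 / 3)) {a..a+1}"
      by (rule fundamental_theorem_of_calculus)
        (auto intro!: derivative_eq_intros simp flip: has_real_derivative_iff_has_vector_derivative)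
    then show ?thesis by (simp add: c_def power3_eq_cube)
  qed
  let ?I = "(\<Sum>y\<in>B. \<Sum>z\<in>B. d y * d z * (a + 1 - max y z))
      - 2 * l * (\<Sum>y\<in>B. d y * ((1/4 - (y - c)\<^sup>2) / 2)) + l\<^sup>2 * (1/12)"
  have "((\<lambda>t. (\<Sum>y\<in>B. \<Sum>z\<in>B. d y * d z * (s y t * s z t))
      - 2 * l * (\<Sum>y\<in>B. d y * (s y t * (t - c))) + l\<^sup>2 * (t - c)\<^sup>2) has_integral ?I) {a..a+1}"
    by (intro has_integral_add has_integral_diff has_integral_sum has_integral_mult_right i1 i2 i3 fin)
  moreover have "0 \<le> (\<Sum>y\<in>B. \<Sum>z\<in>B. d y * d z * (s y t * s z t))
      - 2 * l * (\<Sum>y\<in>B. d y * (s y t * (t - c))) + l\<^sup>2 * (t - c)\<^sup>2" for t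
  proof -
    define D where "D = (\<Sum>y\<in>B. d y * s y t)"
    have "(\<Sum>y\<in>B. \<Sum>z\<in>B. d y * d z * (s y t * s z t)) = D\<^sup>2"
      by (simp add: D_def power2_eq_square sum_product algebra_simps)
    moreover have "(\<Sum>y\<in>B. d y * (s y t * (t - c))) = D * (t - c)"
      by (simp add: D_def sum_distrib_right mult.assoc)
    ultimately have "(\<Sum>y\<in>B. \<Sum>z\<in>B. d y * d z * (s y t * s z t))
      - 2 * l * (\<Sum>y\<in>B. d y * (s y t * (t - c))) + l\<^sup>2 * (t - c)\<^sup>2 = (D - l * (t - c))\<^sup>2"
      by (simp only:) (simp add: power2_eq_square algebra_simps)
    then show ?thesis by simp
  qed
  ultimately have "0 \<le> ?I" by (rule has_integral_nonneg)
  \<comment> \<open>Since \<open>max y z = (y + z + \<bar>y - z\<bar>) / 2\<close>, every other term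
    has a factor \<open>\<Sum>y\<in>B. d y\<close>, which vanishes.\<close>
  moreover have "(\<Sum>y\<in>B. \<Sum>z\<in>B. d y * d z * (a + 1 - max y z)) = Q"
  proof -
    have "d y * d z * (a + 1 - max y z)
       = (a + 1) * (d y * d z) - (d y * y) * d z / 2 - d y * (d z * z) / 2 - d y * d z * \<bar>y - z\<bar> / 2" for y z
      by (auto simp: max_def abs_if field_simps)
    then have "(\<Sum>y\<in>B. \<Sum>z\<in>B. d y * d z * (a + 1 - max y z))
      = (a + 1) * ((\<Sum>y\<in>B. d y) * (\<Sum>z\<in>B. d z)) - (\<Sum>y\<in>B. d y * y) * (\<Sum>z\<in>B. d z) / 2
        - (\<Sum>y\<in>B. d y) * (\<Sum>z\<in>B. d z * z) / 2 - (\<Sum>y\<in>B. \<Sum>z\<in>B. d y * d z * \<bar>y - z\<bar>) / 2"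
      by (simp only: sum_product sum_subtractf) (simp only: sum_distrib_left sum_divide_distrib)
    then show ?thesis by (simp add: d0 d1 Q_def)
  qed
  moreover have "(\<Sum>y\<in>B. d y * ((1/4 - (y - c)\<^sup>2) / 2)) = - h / 2"
  proof -
    have "d y * ((1/4 - (y - c)\<^sup>2) / 2) = (1/8 - c\<^sup>2/2) * d y + c * (d y * y) - d y * y\<^sup>2 / 2" for y
      by (simp add: power2_eq_square field_simps)
    then have "(\<Sum>y\<in>B. d y * ((1/4 - (y - c)\<^sup>2) / 2)) = (1/8 - c\<^sup>2/2) * (\<Sum>y\<in>B. d y)
        + c * (\<Sum>y\<in>B. d y * y) - (\<Sum>y\<in>B. d y * y\<^sup>2) / 2"
      by (simp only: sum.distrib sum_subtractf sum_distrib_left sum_divide_distrib)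
    then show ?thesis by (simp add: d0 d1 h_def)
  qed
  ultimately have "0 \<le> Q - 2 * l * (- h / 2) + l\<^sup>2 * (1/12)" by simp
  then show ?thesis
    unfolding l_def h_def[symmetric] Q_def[symmetric] by (simp add: power2_eq_square)
qed

section \<open>Sweeps and their energy\<close>

definition chord :: "real \<Rightarrow> (real \<Rightarrow> real) \<Rightarrow> real \<Rightarrow> real" where
  "chord a g x = (if x \<in> {a..a+1} then (a + 1 - x) * g a + (x - a) * g (a + 1) else g x)"

text \<open>The weights \<open>a + 1 - y\<close> and \<open>y - a\<close> are the barycentric
  coordinates of \<open>y\<close> in the interval, so total mass and mean are preserved.\<close>

definition sweep :: "real \<Rightarrow> (real \<Rightarrow> real) \<Rightarrow> real \<Rightarrow> real" where
  "sweep a \<rho> z = (if z \<in> {a..a+1} then 0 else \<rho> z)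
     + (if z = a then \<Sum>y\<in>supp \<rho> \<inter> {a..a+1}. \<rho> y * (a + 1 - y) else 0)
     + (if z = a + 1 then \<Sum>y\<in>supp \<rho> \<inter> {a..a+1}. \<rho> y * (y - a) else 0)"

text \<open>The kernel \<open>\<bar>x - y\<bar> / 2\<close> is a fundamental solution of the second
  derivative: \<open>\<rho>\<close> is the second derivative of its potential.\<close>

definition pot :: "(real \<Rightarrow> real) \<Rightarrow> real \<Rightarrow> real" where
  "pot \<rho> x = integ \<rho> (\<lambda>y. \<bar>x - y\<bar>) / 2"

lemma supp_sweep: "supp (sweep a \<rho>) \<subseteq> supp \<rho> \<union> {a, a + 1}"
  by (auto simp: supp_def sweep_def)

lemma distribution_sweep: "distribution \<rho> \<Longrightarrow> distribution (sweep a \<rho>)"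
  using finite_subset[OF supp_sweep, of \<rho> a]
  by (auto simp: distribution_def sweep_def intro!: sum_nonneg add_nonneg_nonneg)

text \<open>Sweeping is adjoint to \<open>chord\<close>: the barycentric masses replacing a unit
  mass at \<open>y\<close> integrate \<open>g\<close> to its linear interpolation at
  \<open>y\<close>.\<close>

lemma integ_sweep:
  assumes fin: "finite (supp \<rho>)"
  shows "integ (sweep a \<rho>) g = integ \<rho> (chord a g)"
proof -
  let ?B = "supp \<rho> \<union> {a, a + 1}"
  let ?I = "supp \<rho> \<inter> {a..a+1}"
  define P where "P = (\<Sum>y\<in>?I. \<rho> y * (a + 1 - y))"
  define Q where "Q = (\<Sum>y\<in>?I. \<rho> y * (y - a))"
  have finB: "finite ?B" using fin by simp
  have "integ (sweep a \<rho>) g = (\<Sum>x\<in>?B. sweep a \<rho> x * g x)"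
    using finB supp_sweep by (rule integ_superset)
  also have "\<dots> = (\<Sum>x\<in>?B. (if x \<in> {a..a+1} then 0 else \<rho> x * g x)
      + (if x = a then P * g a else 0) + (if x = a + 1 then Q * g (a + 1) else 0))"
    by (rule sum.cong) (auto simp: sweep_def P_def Q_def algebra_simps)
  also have "\<dots> = (\<Sum>x\<in>?B. if x \<in> {a..a+1} then 0 else \<rho> x * g x) + P * g a + Q * g (a + 1)"
    using finB by (simp add: sum.distrib sum.delta)
  also have "(\<Sum>x\<in>?B. if x \<in> {a..a+1} then 0 else \<rho> x * g x)
      = (\<Sum>x\<in>supp \<rho>. if x \<in> {a..a+1} then 0 else \<rho> x * g x)"
    by (rule sum.mono_neutral_right) (use fin in \<open>auto simp: supp_def\<close>)
  also have "P = (\<Sum>y\<in>supp \<rho>. if y \<in> {a..a+1} then \<rho> y * (a + 1 - y) else 0)"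
    unfolding P_def using fin by (rule sum.inter_restrict)
  also have "Q = (\<Sum>y\<in>supp \<rho>. if y \<in> {a..a+1} then \<rho> y * (y - a) else 0)"
    unfolding Q_def using fin by (rule sum.inter_restrict)
  finally show ?thesis
    unfolding integ_def sum_distrib_right sum.distrib[symmetric]
    by (simp add: chord_def algebra_simps if_distrib cong: if_cong sum.cong)
       (rule sum.cong, auto simp: algebra_simps)
qed

text \<open>If both points lie in the interval, the interpolation is symmetric in them; if only one
  does, the distance is already affine in that one.\<close>

lemma chord_abs_commute: "chord a (\<lambda>y. \<bar>x - y\<bar>) y = chord a (\<lambda>x. \<bar>x - y\<bar>) x"
  by (auto simp: chord_def abs_if algebra_simps)

lemma pot_sweep:
  assumes fin: "finite (supp \<rho>)"
  shows "pot (sweep a \<rho>) x = chord a (pot \<rho>) x"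
proof -
  have "pot (sweep a \<rho>) x = integ \<rho> (\<lambda>y. chord a (\<lambda>x. \<bar>x - y\<bar>) x) / 2"
    unfolding pot_def integ_sweep[OF fin] chord_abs_commute ..
  also have "\<dots> = chord a (pot \<rho>) x"
  proof (cases "x \<in> {a..a+1}")
    case True
    then show ?thesis
      by (simp add: chord_def pot_def integ_add integ_cmult add_divide_distrib)
  qed (auto simp: chord_def pot_def)
  finally show ?thesis .
qed

lemma chord_chord: "chord a (chord a g) = chord a g"
  by (rule ext) (auto simp: chord_def)

section \<open>Growth of the energy under sweeps\<close>

definition energy :: "(real \<Rightarrow> real) \<Rightarrow> real" where
  "energy \<rho> = integ \<rho> (pot \<rho>)"

text \<open>For the change \<open>d\<close> caused by the sweep, the gain of energy is
  \<open>- integ d (pot d)\<close>. Since \<open>d\<close> lives on a unit interval with vanishing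
  mass and first moment, \<open>second_moment_le_energy\<close> bounds it below.\<close>

lemma energy_sweep:
  assumes fin: "finite (supp \<rho>)"
  shows "energy \<rho> + 3 * (integ (sweep a \<rho>) (\<lambda>x. x\<^sup>2) - integ \<rho> (\<lambda>x. x\<^sup>2))\<^sup>2 \<le> energy (sweep a \<rho>)"
proof -
  define d where "d = (\<lambda>x. sweep a \<rho> x - \<rho> x)"
  have fin': "finite (supp (sweep a \<rho>))"
    using finite_subset[OF supp_sweep] fin by simp
  have d_integ: "integ d g = integ (sweep a \<rho>) g - integ \<rho> g" for g
    unfolding d_def using fin' fin by (rule integ_measure_diff)
  have supp_d: "supp d \<subseteq> {a..a+1}"
    by (auto simp: supp_def d_def sweep_def split: if_splits)
  have fin_d: "finite (supp d)"
    by (rule finite_subset[of _ "supp (sweep a \<rho>) \<union> supp \<rho>"])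
      (use fin fin' in \<open>auto simp: supp_def d_def\<close>)
  have d0: "integ d (\<lambda>x. 1) = 0" and d1: "integ d (\<lambda>x. x) = 0"
  proof -
    have "chord a (\<lambda>x. 1) = (\<lambda>x. 1)" "chord a (\<lambda>x. x) = (\<lambda>x. x)"
      by (auto simp: chord_def algebra_simps)
    then show "integ d (\<lambda>x. 1) = 0" "integ d (\<lambda>x. x) = 0"
      by (simp_all add: d_integ integ_sweep[OF fin])
  qed
  have "3 * (integ d (\<lambda>x. x\<^sup>2))\<^sup>2 \<le> - (\<Sum>y\<in>supp d. \<Sum>z\<in>supp d. d y * d z * \<bar>y - z\<bar>) / 2"
    unfolding integ_def
    by (rule second_moment_le_energy) (use fin_d supp_d d0 d1 in \<open>auto simp: integ_def\<close>)
  also have "\<dots> = - integ d (pot d)"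
    by (simp add: integ_def pot_def sum_distrib_left sum_divide_distrib algebra_simps)
  also have "pot d = (\<lambda>x. pot (sweep a \<rho>) x - pot \<rho> x)"
    by (rule ext) (simp add: pot_def d_integ diff_divide_distrib)
  also have "- integ d (\<lambda>x. pot (sweep a \<rho>) x - pot \<rho> x) = energy (sweep a \<rho>) - energy \<rho>"
  proof -
    \<comment> \<open>As \<open>chord\<close> is idempotent, the mixed terms
      \<open>integ \<rho> (pot (sweep a \<rho>))\<close> and
      \<open>integ (sweep a \<rho>) (pot \<rho>)\<close> both equal the energy after the
      sweep.\<close>
    have p: "pot (sweep a \<rho>) = chord a (pot \<rho>)"
      by (rule ext) (rule pot_sweep[OF fin])
    show ?thesis
      by (simp add: d_integ integ_diff energy_def p integ_sweep[OF fin] chord_chord)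
  qed
  finally show ?thesis by (simp add: d_integ)
qed

text \<open>\<open>N\<close> stands for the number of sweeps applied to a point mass at
  \<open>c\<close>. If they raise the second moment by \<open>h_1, ..., h_N\<close>, the energy is
  at least three times the sum of the \<open>h_i^2\<close>; the last clause is then Cauchy--Schwarz,
  kept as an invariant.\<close>

definition spread_within :: "nat \<Rightarrow> real \<Rightarrow> real \<Rightarrow> (real \<Rightarrow> real) \<Rightarrow> bool" where
  "spread_within N M c \<rho> \<longleftrightarrow> distribution \<rho> \<and> integ \<rho> (\<lambda>x. 1) = M
     \<and> integ \<rho> (\<lambda>x. x) = M * c
     \<and> 3 * (integ \<rho> (\<lambda>x. (x - c)\<^sup>2))\<^sup>2 \<le> real N * energy \<rho>"

lemma pot_nonneg: "distribution \<rho> \<Longrightarrow> 0 \<le> pot \<rho> x"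
  by (auto simp: pot_def intro: integ_nonneg)

lemma energy_nonneg: "distribution \<rho> \<Longrightarrow> 0 \<le> energy \<rho>"
  by (auto simp: energy_def intro: integ_nonneg pot_nonneg)

lemma integ_centered_square:
  "integ \<rho> (\<lambda>x. (x - c)\<^sup>2) = integ \<rho> (\<lambda>x. x\<^sup>2) - 2 * c * integ \<rho> (\<lambda>x. x) + c\<^sup>2 * integ \<rho> (\<lambda>x. 1)"
proof -
  have "(\<lambda>x. (x - c)\<^sup>2) = (\<lambda>x. x\<^sup>2 - 2 * c * x + c\<^sup>2 * 1)"
    by (auto simp: power2_eq_square algebra_simps)
  then show ?thesis by (simp only: integ_add integ_diff integ_cmult)
qed

lemma spread_within_sweep:
  assumes "spread_within N M c \<rho>"
  shows "spread_within (Suc N) M c (sweep a \<rho>)"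
proof -
  have dist: "distribution \<rho>" and fin: "finite (supp \<rho>)"
    and tot: "integ \<rho> (\<lambda>x. 1) = M" and mean: "integ \<rho> (\<lambda>x. x) = M * c"
    and inv: "3 * (integ \<rho> (\<lambda>x. (x - c)\<^sup>2))\<^sup>2 \<le> real N * energy \<rho>"
    using assms by (auto simp: spread_within_def distribution_def)
  have "chord a (\<lambda>x. 1) = (\<lambda>x. 1)" "chord a (\<lambda>x. x) = (\<lambda>x. x)"
    by (auto simp: chord_def algebra_simps)
  then have tot': "integ (sweep a \<rho>) (\<lambda>x. 1) = M" and mean': "integ (sweep a \<rho>) (\<lambda>x. x) = M * c"
    using tot mean by (simp_all add: integ_sweep[OF fin])
  define V where "V = integ \<rho> (\<lambda>x. (x - c)\<^sup>2)"
  define h where "h = integ (sweep a \<rho>) (\<lambda>x. (x - c)\<^sup>2) - V"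
  have "h = integ (sweep a \<rho>) (\<lambda>x. x\<^sup>2) - integ \<rho> (\<lambda>x. x\<^sup>2)"
    by (simp add: h_def V_def integ_centered_square tot tot' mean mean')
  then have e: "energy \<rho> + 3 * h\<^sup>2 \<le> energy (sweep a \<rho>)"
    using energy_sweep[OF fin, of a] by simp
  \<comment> \<open>The inductive form of Cauchy--Schwarz,
    \<open>(V + h)^2 \<le> (N + 1) * (V^2 / N + h^2)\<close>, comes from
    \<open>0 \<le> (V - N * h)^2\<close>; for \<open>N = 0\<close> the invariant forces
    \<open>V = 0\<close>.\<close>
  have "3 * (V + h)\<^sup>2 \<le> real (Suc N) * (energy \<rho> + 3 * h\<^sup>2)"
  proof (cases "N = 0")
    case True
    then have "V = 0" using inv by (simp add: V_def)
    then show ?thesis using True energy_nonneg[OF dist] by simp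
  next
    case False
    have "0 \<le> 3 * (V - real N * h)\<^sup>2" by simp
    also have "\<dots> = real (Suc N) * (3 * V\<^sup>2 + real N * (3 * h\<^sup>2)) - real N * (3 * (V + h)\<^sup>2)"
      by (simp add: power2_eq_square algebra_simps)
    also have "\<dots> \<le> real (Suc N) * (real N * energy \<rho> + real N * (3 * h\<^sup>2)) - real N * (3 * (V + h)\<^sup>2)"
      using inv by (intro diff_right_mono mult_left_mono add_right_mono) (auto simp: V_def)
    also have "\<dots> = real N * (real (Suc N) * (energy \<rho> + 3 * h\<^sup>2) - 3 * (V + h)\<^sup>2)"
      by (simp add: algebra_simps)
    finally show ?thesis using False by (simp add: zero_le_mult_iff)
  qed
  also have "\<dots> \<le> real (Suc N) * energy (sweep a \<rho>)"
    using e by (rule mult_left_mono) simp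
  finally show ?thesis
    using distribution_sweep[OF dist] tot' mean'
    by (simp add: spread_within_def h_def)
qed

lemma convex_pot:
  assumes "distribution \<rho>" "a \<le> x" "x \<le> a + 1"
  shows "pot \<rho> x \<le> (a + 1 - x) * pot \<rho> a + (x - a) * pot \<rho> (a + 1)"
proof -
  have "\<bar>x - y\<bar> \<le> (a + 1 - x) * \<bar>a - y\<bar> + (x - a) * \<bar>a + 1 - y\<bar>" for y
  proof -
    have "x - y = (a + 1 - x) * (a - y) + (x - a) * (a + 1 - y)" by (simp add: algebra_simps)
    then have "\<bar>x - y\<bar> \<le> \<bar>(a + 1 - x) * (a - y)\<bar> + \<bar>(x - a) * (a + 1 - y)\<bar>"
      by linarith
    then show ?thesis using assms by (simp add: abs_mult)
  qed
  then have "integ \<rho> (\<lambda>y. \<bar>x - y\<bar>)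
      \<le> integ \<rho> (\<lambda>y. (a + 1 - x) * \<bar>a - y\<bar> + (x - a) * \<bar>a + 1 - y\<bar>)"
    by (rule integ_mono[OF assms(1)])
  then show ?thesis by (simp add: pot_def integ_add integ_cmult)
qed

lemma pot_le_pot_sweep:
  assumes "distribution \<rho>"
  shows "pot \<rho> x \<le> pot (sweep a \<rho>) x"
  using assms convex_pot[OF assms, of a x] by (auto simp: pot_sweep distribution_def chord_def)

section \<open>Domination of a move sequence by sweeps\<close>

text \<open>The stop-loss function of \<open>\<nu>\<close>: convex, with right derivative at
  \<open>x\<close> equal to minus the mass beyond \<open>x\<close>.\<close>

definition tail :: "(real \<Rightarrow> real) \<Rightarrow> real \<Rightarrow> real" where
  "tail \<nu> x = integ \<nu> (\<lambda>y. max (y - x) 0)"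

lemma tail_nonneg: "distribution \<nu> \<Longrightarrow> 0 \<le> tail \<nu> x"
  by (auto simp: tail_def intro: integ_nonneg)

text \<open>Beyond \<open>r\<close> the slope of \<open>tail\<close> is at least \<open>- m\<close>,
  so adding a slope \<open>m\<close>, as in \<open>dominates\<close>, makes it nondecreasing
  there.\<close>

lemma tail_le_add_mass:
  assumes dist: "distribution \<nu>" and mass: "mass \<nu> {y. y > r} \<le> m" and "r \<le> x" "x \<le> x'"
  shows "tail \<nu> x \<le> tail \<nu> x' + m * (x' - x)"
proof -
  have "max (y - x) 0 \<le> max (y - x') 0 + (x' - x) * indicator {y. y > r} y" for y
    using assms by (auto simp: indicator_def max_def)
  then have "tail \<nu> x \<le> tail \<nu> x' + (x' - x) * mass \<nu> {y. y > r}"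
    using integ_mono[OF dist, of "\<lambda>y. max (y - x) 0"
        "\<lambda>y. max (y - x') 0 + (x' - x) * indicator {y. y > r} y"] dist
    by (simp add: tail_def integ_add integ_cmult mass_eq_integ distribution_def)
  also have "\<dots> \<le> tail \<nu> x' + (x' - x) * m"
    using assms by (intro add_left_mono mult_left_mono) auto
  finally show ?thesis by (simp add: mult.commute)
qed

text \<open>Markov's inequality for \<open>max (y - x) 0\<close>.\<close>

lemma mass_le_tail:
  assumes dist: "distribution \<nu>" and "x \<le> e"
  shows "mass \<nu> {y. y \<ge> e} * (e - x) \<le> tail \<nu> x"
proof -
  have "(e - x) * indicator {y. y \<ge> e} y \<le> max (y - x) 0" for y
    using assms by (auto simp: indicator_def max_def)
  then show ?thesis
    using integ_mono[OF dist, of "\<lambda>y. (e - x) * indicator {y. y \<ge> e} y" "\<lambda>y. max (y - x) 0"] dist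
    by (simp add: tail_def integ_cmult mass_eq_integ distribution_def mult.commute)
qed

lemma convex_tail:
  assumes dist: "distribution \<nu>" and "a \<le> x" "x \<le> a + 1"
  shows "tail \<nu> x \<le> (a + 1 - x) * tail \<nu> a + (x - a) * tail \<nu> (a + 1)"
proof -
  have "max (y - x) 0 \<le> (a + 1 - x) * max (y - a) 0 + (x - a) * max (y - (a + 1)) 0" for y
  proof -
    have "y - x = (a + 1 - x) * (y - a) + (x - a) * (y - (a + 1))" by (simp add: algebra_simps)
    also have "\<dots> \<le> (a + 1 - x) * max (y - a) 0 + (x - a) * max (y - (a + 1)) 0"
      using assms by (intro add_mono mult_left_mono) auto
    finally show ?thesis using assms by simp
  qed
  then have "tail \<nu> x
      \<le> integ \<nu> (\<lambda>y. (a + 1 - x) * max (y - a) 0 + (x - a) * max (y - (a + 1)) 0)"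
    unfolding tail_def by (rule integ_mono[OF dist])
  then show ?thesis by (simp add: tail_def integ_add integ_cmult)
qed

text \<open>On the interval of the move, \<open>max (y - x) 0\<close> is affine in \<open>y\<close>
  (either \<open>y - x\<close> or zero), so the vanishing moments annihilate it.\<close>

lemma tail_apply_move:
  assumes "is_move v" "distribution \<nu>" "x \<le> fst v \<or> fst v + 1 \<le> x"
  shows "tail (apply_move v \<nu>) x = tail \<nu> x"
proof -
  have fin: "finite (supp (snd v))" "finite (supp \<nu>)"
    using assms by (auto simp: is_move_def signed_distribution_def distribution_def)
  have sub: "supp (snd v) \<subseteq> {fst v..fst v + 1}"
    and m: "integ (snd v) (\<lambda>x. x ^ 0) = 0" "integ (snd v) (\<lambda>x. x ^ 1) = 0"
    using assms by (auto simp: is_move_def moment_eq_integ)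
  have "integ (snd v) (\<lambda>y. max (y - x) 0) = 0"
  proof (cases "x \<le> fst v")
    case True
    have "integ (snd v) (\<lambda>y. max (y - x) 0) = integ (snd v) (\<lambda>y. y ^ 1 - x * y ^ 0)"
      unfolding integ_def by (rule sum.cong) (use True sub in \<open>auto simp: max_def\<close>)
    then show ?thesis by (simp only: integ_diff integ_cmult m mult_zero_right diff_self)
  next
    case False
    then show ?thesis using assms(3) sub
      unfolding integ_def by (intro sum.neutral) (auto simp: max_def)
  qed
  then show ?thesis
    unfolding tail_def apply_move_def by (simp add: integ_measure_add fin)
qed

text \<open>The new \<open>tail\<close> is convex and keeps its old values at the endpoints, so no
  move lifts it above the chord, which is what a sweep produces.\<close>

lemma tail_apply_move_le_chord:
  assumes "is_move v" "distribution \<nu>" "distribution (apply_move v \<nu>)" "fst v \<le> x" "x \<le> fst v + 1"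
  shows "tail (apply_move v \<nu>) x
    \<le> (fst v + 1 - x) * tail \<nu> (fst v) + (x - fst v) * tail \<nu> (fst v + 1)"
  using convex_tail[OF assms(3-5)] by (simp add: tail_apply_move[OF assms(1,2)])

text \<open>The reflection ignores what happens left of \<open>c\<close>. The tilt matches the
  potential of mass \<open>2 * m\<close> at \<open>c\<close>, so domination holds while the tail
  vanishes beyond \<open>c\<close>.\<close>

definition dominates :: "real \<Rightarrow> real \<Rightarrow> (real \<Rightarrow> real) \<Rightarrow> (real \<Rightarrow> real) \<Rightarrow> bool" where
  "dominates c m \<rho> \<nu> \<longleftrightarrow> (\<forall>x. tail \<nu> (c + \<bar>x - c\<bar>) + m * \<bar>x - c\<bar> \<le> pot \<rho> x)"

text \<open>A move costs no sweep if its center is at most \<open>r\<close>, one if its center is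
  beyond \<open>r\<close> but its interval starts before \<open>r\<close>, and two if the interval
  starts at \<open>r\<close> or later.\<close>

lemma dominates_apply_move:
  assumes v: "is_move v" and dist: "distribution \<nu>" and dist': "distribution (apply_move v \<nu>)"
    and mass: "mass \<nu> {x. x > r} \<le> m" and mass': "mass (apply_move v \<nu>) {x. x > r} \<le> m"
    and dom: "dominates (r + 1/2) m \<rho> \<nu>" and spread: "spread_within N M c \<rho>"
  shows "\<exists>\<rho>' N'. dominates (r + 1/2) m \<rho>' (apply_move v \<nu>) \<and> spread_within N' M c \<rho>'
     \<and> N' \<le> N + (if center v > r then 2 else 0)"
proof -
  define a where "a = fst v"
  define s where "s = r + 1/2"
  define \<nu>' where "\<nu>' = apply_move v \<nu>"
  define H where "H = (\<lambda>t. tail \<nu> (s + t) + m * t)"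
  define H' where "H' = (\<lambda>t. tail \<nu>' (s + t) + m * t)"
  note \<nu>'_def[symmetric, simp]
  have dom: "H \<bar>x - s\<bar> \<le> pot \<rho> x" for x
    using dom by (auto simp: dominates_def H_def s_def)
  have goal: "dominates (r + 1/2) m \<rho>' \<nu>'" if "\<And>x. H' \<bar>x - s\<bar> \<le> pot \<rho>' x" for \<rho>'
    using that by (auto simp: dominates_def H'_def s_def)
  \<comment> \<open>\<open>t\<close> is a signed distance from \<open>s = r + 1/2\<close>, so
    \<open>-1/2 \<le> t\<close> puts \<open>s + t\<close> in the range where \<open>tail\<close> has
    slope at least \<open>- m\<close>.\<close>
  have H_mono: "H t \<le> H t'" if "-1/2 \<le> t" "t \<le> t'" for t t'
    using tail_le_add_mass[OF dist mass, of "s + t" "s + t'"] that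
    by (simp add: H_def s_def algebra_simps)
  have H'_mono: "H' t \<le> H' t'" if "-1/2 \<le> t" "t \<le> t'" for t t'
    using tail_le_add_mass[OF dist' mass', of "s + t" "s + t'"] that
    by (simp add: H'_def s_def algebra_simps)
  have H'_eq: "H' t = H t" if "s + t \<le> a \<or> a + 1 \<le> s + t" for t
    using tail_apply_move[OF v dist, of "s + t"] that by (auto simp: H'_def H_def a_def)
  have H'_chord: "H' t \<le> (a + 1 - (s + t)) * H (a - s) + (s + t - a) * H (a + 1 - s)"
    if "a \<le> s + t" "s + t \<le> a + 1" for t
  proof -
    have "m * t = (a + 1 - (s + t)) * (m * (a - s)) + (s + t - a) * (m * (a + 1 - s))"
      by (simp add: algebra_simps)
    then show ?thesis
      using tail_apply_move_le_chord[OF v dist dist', of "s + t"] that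
      by (simp add: H'_def H_def a_def algebra_simps)
  qed
  have d\<rho>: "distribution \<rho>" and fin: "finite (supp \<rho>)"
    using spread by (auto simp: spread_within_def distribution_def)
  consider "a + 1/2 \<le> r" | "r < a + 1/2" "a < r" | "r \<le> a" by linarith
  then show ?thesis
  proof cases
    case 1
    have "H' \<bar>x - s\<bar> = H \<bar>x - s\<bar>" for x
      using 1 abs_ge_zero[of "x - s"] by (intro H'_eq) (simp only: s_def, linarith)
    then have "H' \<bar>x - s\<bar> \<le> pot \<rho> x" for x
      using dom by simp
    then have "dominates (r + 1/2) m \<rho> \<nu>'" by (rule goal)
    then show ?thesis using spread by (intro exI[of _ \<rho>] exI[of _ N]) simp
  next
    case 2
    \<comment> \<open>Left of \<open>r\<close> the slope of \<open>tail\<close> is not bounded by \<open>m\<close>, so the chord at \<open>a\<close> is useless; as the move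
      ends before \<open>r + 1\<close>, a single sweep of the symmetric interval \<open>[r, r + 1]\<close> suffices.\<close>
    have "H' \<bar>x - s\<bar> \<le> pot (sweep r \<rho>) x" for x
    proof (cases "x \<in> {r..r+1}")
      case True
      have ends: "H (1/2) \<le> pot \<rho> r" "H (1/2) \<le> pot \<rho> (r + 1)"
        using dom[of r] dom[of "r + 1"] by (simp_all add: s_def)
      have "H' \<bar>x - s\<bar> \<le> H' (1/2)" using True by (intro H'_mono) (auto simp: s_def abs_if)
      also have "H' (1/2) = H (1/2)" using 2 by (intro H'_eq) (auto simp: s_def)
      also have "\<dots> = (r + 1 - x) * H (1/2) + (x - r) * H (1/2)" by (simp add: algebra_simps)
      also have "\<dots> \<le> (r + 1 - x) * pot \<rho> r + (x - r) * pot \<rho> (r + 1)"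
        using True ends by (intro add_mono mult_left_mono) auto
      also have "\<dots> = pot (sweep r \<rho>) x" using True by (simp add: pot_sweep[OF fin] chord_def)
      finally show ?thesis .
    next
      case False
      then have "H' \<bar>x - s\<bar> = H \<bar>x - s\<bar>"
        using 2 by (intro H'_eq) (auto simp: s_def abs_if)
      then show ?thesis using False dom[of x] by (auto simp: pot_sweep[OF fin] chord_def)
    qed
    then have "dominates (r + 1/2) m (sweep r \<rho>) \<nu>'" by (rule goal)
    moreover have "spread_within (Suc N) M c (sweep r \<rho>)"
      using spread by (rule spread_within_sweep)
    ultimately show ?thesis using 2
      by (intro exI[of _ "sweep r \<rho>"] exI[of _ "Suc N"]) (simp add: center_def a_def)
  next
    case 3
    \<comment> \<open>\<open>{b..b+1}\<close> is the mirror image of \<open>{a..a+1}\<close> about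
      \<open>s\<close>.\<close>
    define b where "b = 2 * s - (a + 1)"
    define \<rho>1 where "\<rho>1 = sweep a \<rho>"
    define \<rho>2 where "\<rho>2 = sweep b \<rho>1"
    have sp1: "spread_within (Suc N) M c \<rho>1"
      unfolding \<rho>1_def using spread by (rule spread_within_sweep)
    then have d1: "distribution \<rho>1" and fin1: "finite (supp \<rho>1)"
      by (auto simp: spread_within_def distribution_def)
    have sp2: "spread_within (Suc (Suc N)) M c \<rho>2"
      unfolding \<rho>2_def using sp1 by (rule spread_within_sweep)
    have le1: "pot \<rho> x \<le> pot \<rho>1 x" for x
      unfolding \<rho>1_def using d\<rho> by (rule pot_le_pot_sweep)
    have le2: "pot \<rho>1 x \<le> pot \<rho>2 x" for x
      unfolding \<rho>2_def using d1 by (rule pot_le_pot_sweep)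
    \<comment> \<open>For \<open>a < s\<close> the chord uses \<open>H\<close> at a negative
      argument, about which domination says nothing; monotonicity passes to the reflected
      point.\<close>
    have Ha: "H (a - s) \<le> H \<bar>a - s\<bar>" using 3 by (intro H_mono) (auto simp: s_def)
    have Hb: "H (a + 1 - s) = H \<bar>a + 1 - s\<bar>" using 3 by (simp add: s_def)
    have refl: "\<bar>b - s\<bar> = \<bar>a + 1 - s\<bar>" "\<bar>b + 1 - s\<bar> = \<bar>a - s\<bar>" by (auto simp: b_def)
    have right: "H' \<bar>x - s\<bar> \<le> pot \<rho>1 x" if "s \<le> x" for x
    proof (cases "x \<in> {a..a+1}")
      case True
      have "H' \<bar>x - s\<bar> \<le> (a + 1 - x) * H (a - s) + (x - a) * H (a + 1 - s)"
        using H'_chord[of "x - s"] True that by simp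
      also have "\<dots> \<le> (a + 1 - x) * pot \<rho> a + (x - a) * pot \<rho> (a + 1)"
        using True Ha Hb dom[of a] dom[of "a + 1"] by (intro add_mono mult_left_mono) auto
      also have "\<dots> = pot \<rho>1 x" using True by (simp add: \<rho>1_def pot_sweep[OF fin] chord_def)
      finally show ?thesis .
    next
      case False
      then show ?thesis using dom[of x] le1[of x] H'_eq[of "\<bar>x - s\<bar>"] that by auto
    qed
    have left: "H' \<bar>x - s\<bar> \<le> pot \<rho>2 x" if "x \<le> s" for x
    proof (cases "x \<in> {b..b+1}")
      case True
      have "H' \<bar>x - s\<bar> \<le> (x - b) * H (a - s) + (b + 1 - x) * H (a + 1 - s)"
        using H'_chord[of "s - x"] True that by (simp add: b_def algebra_simps)
      also have "\<dots> \<le> (x - b) * pot \<rho>1 (b + 1) + (b + 1 - x) * pot \<rho>1 b"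
        using True Ha Hb dom[of b] dom[of "b + 1"] le1[of b] le1[of "b + 1"]
        by (intro add_mono mult_left_mono) (auto simp: refl)
      also have "\<dots> = pot \<rho>2 x" using True by (simp add: \<rho>2_def pot_sweep[OF fin1] chord_def)
      finally show ?thesis .
    next
      case False
      then have "s + \<bar>x - s\<bar> \<le> a \<or> a + 1 \<le> s + \<bar>x - s\<bar>" using that by (auto simp: b_def)
      then show ?thesis using dom[of x] le1[of x] le2[of x] H'_eq[of "\<bar>x - s\<bar>"] by auto
    qed
    \<comment> \<open>The second sweep may touch the right half too, but sweeps only raise the
      potential.\<close>
    have "H' \<bar>x - s\<bar> \<le> pot \<rho>2 x" for x
      using left[of x] right[of x] le2[of x] by linarith
    then have "dominates (r + 1/2) m \<rho>2 \<nu>'" by (rule goal)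
    then show ?thesis using sp2 3
      by (intro exI[of _ \<rho>2] exI[of _ "Suc (Suc N)"]) (simp add: center_def a_def)
  qed
qed

lemma dominates_states:
  assumes "valid_sequence \<nu> vs" "\<forall>\<nu>'\<in>set (states \<nu> vs). mass \<nu>' {x. x > r} \<le> m"
    and "dominates (r + 1/2) m \<rho> \<nu>" "spread_within N M c \<rho>" "\<nu>' \<in> set (states \<nu> vs)"
  shows "\<exists>\<rho>' N'. dominates (r + 1/2) m \<rho>' \<nu>' \<and> spread_within N' M c \<rho>'
     \<and> N' \<le> N + 2 * length (filter (\<lambda>v. center v > r) vs)"
  using assms
proof (induction vs arbitrary: \<nu> \<rho> N)
  case Nil
  then show ?case by auto
next
  case (Cons v vs)
  show ?case
  proof (cases "\<nu>' = \<nu>")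
    case True
    then show ?thesis using Cons.prems by (intro exI[of _ \<rho>] exI[of _ N]) auto
  next
    case False
    have hd: "\<mu> \<in> set (states \<mu> us)" for \<mu> us by (cases us) auto
    have v: "is_move v" "distribution \<nu>" "distribution (apply_move v \<nu>)"
      "mass \<nu> {x. x > r} \<le> m" "mass (apply_move v \<nu>) {x. x > r} \<le> m"
      using Cons.prems hd by (auto simp: valid_sequence_def)
    obtain \<rho>1 N1 where 1: "dominates (r + 1/2) m \<rho>1 (apply_move v \<nu>)" "spread_within N1 M c \<rho>1"
      "N1 \<le> N + (if center v > r then 2 else 0)"
      using dominates_apply_move[OF v Cons.prems(3,4)] by blast
    have "valid_sequence (apply_move v \<nu>) vs"
      using Cons.prems by (auto simp: valid_sequence_def)
    from Cons.IH[OF this _ 1(1,2)] Cons.prems False obtain \<rho>' N'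
      where "dominates (r + 1/2) m \<rho>' \<nu>'" "spread_within N' M c \<rho>'"
        "N' \<le> N1 + 2 * length (filter (\<lambda>v. center v > r) vs)"
      by auto
    then show ?thesis using 1(3) by (intro exI[of _ \<rho>'] exI[of _ N']) (auto split: if_splits)
  qed
qed

section \<open>Second moment and energy\<close>

text \<open>The graph bounds two right isosceles triangles with legs \<open>R + (y - c)\<close> and
  \<open>R - (y - c)\<close>.\<close>

lemma has_integral_abs_diff:
  fixes c y R :: real
  assumes "\<bar>y - c\<bar> \<le> R"
  shows "((\<lambda>x. \<bar>x - y\<bar>) has_integral ((y - c)\<^sup>2 + R\<^sup>2)) {c - R..c + R}"
proof -
  have le: "c - R \<le> y" "y \<le> c + R" using assms by auto
  have "((\<lambda>x. y - x) has_integral (- ((y - y)\<^sup>2 / 2) - - ((y - (c - R))\<^sup>2 / 2))) {c - R..y}"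
    by (rule fundamental_theorem_of_calculus[OF le(1)])
      (auto intro!: derivative_eq_intros simp: field_simps
        simp flip: has_real_derivative_iff_has_vector_derivative)
  then have 1: "((\<lambda>x. \<bar>x - y\<bar>) has_integral ((y - (c - R))\<^sup>2 / 2)) {c - R..y}"
    by (rule has_integral_eq[rotated, THEN has_integral_eq_rhs]) auto
  have "((\<lambda>x. x - y) has_integral ((c + R - y)\<^sup>2 / 2 - (y - y)\<^sup>2 / 2)) {y..c + R}"
    by (rule fundamental_theorem_of_calculus[OF le(2)])
      (auto intro!: derivative_eq_intros simp flip: has_real_derivative_iff_has_vector_derivative)
  then have 2: "((\<lambda>x. \<bar>x - y\<bar>) has_integral ((c + R - y)\<^sup>2 / 2)) {y..c + R}"
    by (rule has_integral_eq[rotated, THEN has_integral_eq_rhs]) auto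
  have "(y - (c - R))\<^sup>2 / 2 + (c + R - y)\<^sup>2 / 2 = (y - c)\<^sup>2 + R\<^sup>2"
    by (simp add: power2_eq_square field_simps)
  then show ?thesis using has_integral_combine[OF le 1 2] by simp
qed

text \<open>Integrating the potential over a long interval centred at \<open>c\<close> recovers the second moment.\<close>
lemma second_moment_ge:
  assumes dist: "distribution \<rho>" and tot: "integ \<rho> (\<lambda>x. 1) = 2 * m"
    and dom: "dominates c m \<rho> \<nu>" and dist': "distribution \<nu>"
    and p: "p \<le> mass \<nu> {x. x \<ge> c + d}" and d: "0 \<le> d"
  shows "2 * p * d\<^sup>2 \<le> integ \<rho> (\<lambda>x. (x - c)\<^sup>2)"
proof -
  have fin: "finite (supp \<rho>)" using dist by (simp add: distribution_def)
  define R where "R = Max (insert d ((\<lambda>y. \<bar>y - c\<bar>) ` supp \<rho>))"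
  have R: "\<bar>y - c\<bar> \<le> R" if "y \<in> supp \<rho>" for y
    unfolding R_def by (rule Max_ge) (use fin that in auto)
  have dR: "d \<le> R" unfolding R_def by (rule Max_ge) (use fin in auto)
  have "((\<lambda>x. (\<Sum>y\<in>supp \<rho>. \<rho> y * \<bar>x - y\<bar>)) has_integral
      (\<Sum>y\<in>supp \<rho>. \<rho> y * ((y - c)\<^sup>2 + R\<^sup>2))) {c - R..c + R}"
    by (intro has_integral_sum fin has_integral_mult_right has_integral_abs_diff R)
  from has_integral_divide[OF this, of 2]
  have 1: "(pot \<rho> has_integral (integ \<rho> (\<lambda>y. (y - c)\<^sup>2 + R\<^sup>2 * 1) / 2)) {c - R..c + R}"
    by (simp add: pot_def[abs_def] integ_def)
  \<comment> \<open>The term with \<open>p\<close> is the hat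
    \<open>p * max (d - \<bar>x - c\<bar>) 0\<close> of area \<open>p * d^2\<close>, written so that
    \<open>has_integral_abs_diff\<close> applies.\<close>
  have "((\<lambda>x. m * \<bar>x - c\<bar> + p * ((\<bar>x - (c + d)\<bar> + \<bar>x - (c - d)\<bar>) / 2 - \<bar>x - c\<bar>)) has_integral
    (m * ((c - c)\<^sup>2 + R\<^sup>2) + p * ((((c + d) - c)\<^sup>2 + R\<^sup>2 + (((c - d) - c)\<^sup>2 + R\<^sup>2)) / 2 - ((c - c)\<^sup>2 + R\<^sup>2))))
    {c - R..c + R}"
    by (intro has_integral_add has_integral_diff has_integral_mult_right has_integral_divide
        has_integral_abs_diff) (use d dR in auto)
  then have 2: "((\<lambda>x. m * \<bar>x - c\<bar> + p * ((\<bar>x - (c + d)\<bar> + \<bar>x - (c - d)\<bar>) / 2 - \<bar>x - c\<bar>)) has_integral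
    (m * R\<^sup>2 + p * d\<^sup>2)) {c - R..c + R}"by (simp add: add_divide_distrib)
  have le: "m * \<bar>x - c\<bar> + p * ((\<bar>x - (c + d)\<bar> + \<bar>x - (c - d)\<bar>) / 2 - \<bar>x - c\<bar>) \<le> pot \<rho> x" for x
  proof -
    have hat: "(\<bar>x - (c + d)\<bar> + \<bar>x - (c - d)\<bar>) / 2 - \<bar>x - c\<bar> = max (d - \<bar>x - c\<bar>) 0"
      using d by (auto simp: max_def abs_if field_simps)
    have "p * max (d - \<bar>x - c\<bar>) 0 \<le> tail \<nu> (c + \<bar>x - c\<bar>)"
    proof (cases "\<bar>x - c\<bar> \<le> d")
      case True
      have "p * (d - \<bar>x - c\<bar>) \<le> mass \<nu> {x. x \<ge> c + d} * (c + d - (c + \<bar>x - c\<bar>))"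
        using p True by (simp add: mult_right_mono)
      also have "\<dots> \<le> tail \<nu> (c + \<bar>x - c\<bar>)" using True by (intro mass_le_tail dist') auto
      finally show ?thesis using True by simp
    next
      case False
      then show ?thesis using tail_nonneg[OF dist'] by simp
    qed
    then show ?thesis using dom unfolding hat dominates_def by (smt (verit))
  qed
  \<comment> \<open>The right side contains \<open>m * R^2\<close> as well, so \<open>R\<close>
    cancels.\<close>
  have "m * R\<^sup>2 + p * d\<^sup>2 \<le> integ \<rho> (\<lambda>y. (y - c)\<^sup>2 + R\<^sup>2 * 1) / 2"
    by (rule has_integral_le[OF 2 1]) (rule le)
  also have "\<dots> = integ \<rho> (\<lambda>y. (y - c)\<^sup>2) / 2 + m * R\<^sup>2"
    by (simp only: integ_add integ_cmult tot) simp
  finally show ?thesis by simp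
qed

section \<open>Upper bounds for the energy and the second moment\<close>

lemma energy_le:
  assumes dist: "distribution \<rho>" and tot: "integ \<rho> (\<lambda>x. 1) = M"
  shows "energy \<rho> \<le> M * integ \<rho> (\<lambda>x. \<bar>x - c\<bar>)"
proof -
  define A where "A = integ \<rho> (\<lambda>x. \<bar>x - c\<bar>)"
  have "pot \<rho> x \<le> (M / 2) * \<bar>x - c\<bar> + (A / 2) * 1" for x
  proof -
    have "integ \<rho> (\<lambda>y. \<bar>x - y\<bar>) \<le> integ \<rho> (\<lambda>y. \<bar>x - c\<bar> * 1 + \<bar>y - c\<bar>)"
      by (rule integ_mono[OF dist]) auto
    also have "\<dots> = \<bar>x - c\<bar> * M + A"
      by (simp only: integ_add integ_cmult tot A_def)
    finally show ?thesis by (simp add: pot_def field_simps)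
  qed
  then have "energy \<rho> \<le> integ \<rho> (\<lambda>x. (M / 2) * \<bar>x - c\<bar> + (A / 2) * 1)"
    unfolding energy_def by (rule integ_mono[OF dist])
  also have "\<dots> = M / 2 * A + A / 2 * M"
    by (simp only: integ_add integ_cmult tot A_def)
  finally show ?thesis by (simp add: A_def)
qed

lemma first_absolute_moment_sq_le:
  assumes dist: "distribution \<rho>" and tot: "integ \<rho> (\<lambda>x. 1) = M" and M: "0 < M"
  shows "(integ \<rho> (\<lambda>x. \<bar>x - c\<bar>))\<^sup>2 \<le> M * integ \<rho> (\<lambda>x. (x - c)\<^sup>2)"
proof -
  define A where "A = integ \<rho> (\<lambda>x. \<bar>x - c\<bar>)"
  define V where "V = integ \<rho> (\<lambda>x. (x - c)\<^sup>2)"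
  have "0 \<le> integ \<rho> (\<lambda>x. (M * \<bar>x - c\<bar> - A)\<^sup>2)" by (rule integ_nonneg[OF dist]) simp
  also have "(\<lambda>x. (M * \<bar>x - c\<bar> - A)\<^sup>2) = (\<lambda>x. M\<^sup>2 * (x - c)\<^sup>2 - (2 * M * A) * \<bar>x - c\<bar> + A\<^sup>2 * 1)"
  proof
    fix x
    have "(M * \<bar>x - c\<bar> - A)\<^sup>2 = M\<^sup>2 * \<bar>x - c\<bar>\<^sup>2 - (2 * M * A) * \<bar>x - c\<bar> + A\<^sup>2 * 1"
      by (simp only: power2_eq_square) (simp add: algebra_simps)
    then show "(M * \<bar>x - c\<bar> - A)\<^sup>2 = M\<^sup>2 * (x - c)\<^sup>2 - (2 * M * A) * \<bar>x - c\<bar> + A\<^sup>2 * 1" by simp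
  qed
  also have "integ \<rho> \<dots> = M\<^sup>2 * V - 2 * M * A * A + A\<^sup>2 * M"
    by (simp only: integ_add integ_diff integ_cmult tot A_def V_def)
  also have "\<dots> = M * (M * V - A\<^sup>2)" by (simp add: power2_eq_square algebra_simps)
  finally show ?thesis using M by (simp add: zero_le_mult_iff A_def V_def)
qed

text \<open>Chaining \<open>3 * V^2 \<le> N * energy\<close>, \<open>energy \<le> M * A\<close> and
  \<open>A^2 \<le> M * V\<close> gives \<open>9 * V^4 \<le> N^2 * M^3 * V\<close>.\<close>

lemma second_moment_le:
  assumes spread: "spread_within N M c \<rho>" and M: "0 < M"
  shows "9 * (integ \<rho> (\<lambda>x. (x - c)\<^sup>2)) ^ 3 \<le> (real N)\<^sup>2 * M ^ 3"
proof -
  define A where "A = integ \<rho> (\<lambda>x. \<bar>x - c\<bar>)"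
  define V where "V = integ \<rho> (\<lambda>x. (x - c)\<^sup>2)"
  have dist: "distribution \<rho>" and tot: "integ \<rho> (\<lambda>x. 1) = M"
    and inv: "3 * V\<^sup>2 \<le> real N * energy \<rho>"
    using spread by (auto simp: spread_within_def V_def)
  have V0: "0 \<le> V" unfolding V_def by (rule integ_nonneg[OF dist]) simp
  have "3 * V\<^sup>2 \<le> real N * (M * A)"
    using inv mult_left_mono[OF energy_le[OF dist tot, of c], of "real N"] by (simp add: A_def)
  then have "(3 * V\<^sup>2)\<^sup>2 \<le> (real N * (M * A))\<^sup>2" by (rule power_mono) simp
  also have "\<dots> = (real N)\<^sup>2 * M\<^sup>2 * A\<^sup>2" by (simp add: power_mult_distrib)
  also have "\<dots> \<le> (real N)\<^sup>2 * M\<^sup>2 * (M * V)"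
    using first_absolute_moment_sq_le[OF dist tot M, of c]
    by (intro mult_left_mono) (auto simp: A_def V_def)
  finally have "V * (9 * V ^ 3) \<le> V * ((real N)\<^sup>2 * M ^ 3)"
    by (simp add: power2_eq_square power3_eq_cube algebra_simps)
  then show ?thesis using V0 M by (cases "V = 0") (auto simp: V_def)
qed

section \<open>Decay of the mass far to the right\<close>

lemma mass_eq_0_iff: "distribution \<nu> \<Longrightarrow> mass \<nu> A = 0 \<longleftrightarrow> (\<forall>x\<in>A. \<nu> x = 0)"
  unfolding mass_def distribution_def by (subst sum_nonneg_eq_0_iff) (auto simp: supp_def)

lemma tail_eq_0: "\<forall>y>r. \<nu> y = 0 \<Longrightarrow> r \<le> x \<Longrightarrow> tail \<nu> x = 0"
  unfolding tail_def integ_def by (rule sum.neutral) (auto simp: max_def)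

text \<open>The interval of a move with center at most \<open>r\<close> ends at or before
  \<open>r + 1/2\<close>, so no mass is ever put beyond that point.\<close>

lemma states_eq_0:
  assumes "\<nu>' \<in> set (states \<nu> vs)" "\<forall>v\<in>set vs. is_move v \<and> center v \<le> r"
    and "\<forall>x>r + 1/2. \<nu> x = 0" "r + 1/2 < x"
  shows "\<nu>' x = 0"
  using assms
proof (induction vs arbitrary: \<nu>)
  case (Cons v vs)
  have "apply_move v \<nu> y = 0" if "r + 1/2 < y" for y
    using Cons.prems that by (force simp: apply_move_def is_move_def center_def supp_def)
  then show ?case using Cons.prems Cons.IH[of "apply_move v \<nu>"] by auto
qed auto

lemma integ_one_states:
  assumes "\<nu>' \<in> set (states \<nu> vs)" "\<forall>v\<in>set vs. is_move v" "finite (supp \<nu>)"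
  shows "integ \<nu>' (\<lambda>x. 1) = integ \<nu> (\<lambda>x. 1)"
  using assms
proof (induction vs arbitrary: \<nu>)
  case (Cons v vs)
  have fin: "finite (supp (snd v))" and m: "integ (snd v) (\<lambda>x. 1) = 0"
    using Cons.prems by (auto simp: is_move_def signed_distribution_def moment_eq_integ)
  have "finite (supp (apply_move v \<nu>))"
    by (rule finite_subset[of _ "supp \<nu> \<union> supp (snd v)"])
      (use Cons.prems fin in \<open>auto simp: supp_def apply_move_def\<close>)
  moreover have "integ (apply_move v \<nu>) (\<lambda>x. 1) = integ \<nu> (\<lambda>x. 1)"
    unfolding apply_move_def using Cons.prems fin m by (simp add: integ_measure_add)
  ultimately show ?case using Cons.prems Cons.IH[of "apply_move v \<nu>"] by auto
qed auto

text \<open>Here \<open>t\<close> is the cube root of the mass bound \<open>m\<close>. If more than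
  \<open>m / 8\<close> got this far, then \<open>V \<ge> 25/16 * t^5\<close>, while
  \<open>N \<le> 2 * m\<close> sweeps give \<open>9 * V^3 \<le> (2 * m)^5 = 32 * t^15\<close>. The
  constant 5/2 works because \<open>9 * (25/16)^3 > 32\<close>.\<close>

lemma mass_drop:
  assumes valid: "valid_sequence \<mu> vs" and init: "\<forall>x>0. \<mu> x = 0" and r: "0 \<le> r" and t: "0 < t"
    and mass: "\<forall>\<nu>\<in>set (states \<mu> vs). mass \<nu> {x. x > r} \<le> t ^ 3"
    and count: "real (length (filter (\<lambda>v. center v > r) vs)) \<le> t ^ 3"
    and \<nu>: "\<nu> \<in> set (states \<mu> vs)"
  shows "mass \<nu> {x. x \<ge> r + 1/2 + 5/2 * t} \<le> (t / 2) ^ 3"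
proof (rule ccontr)
  define m where "m = t ^ 3"
  define c where "c = r + 1/2"
  define \<rho> where "\<rho> = (\<lambda>x. if x = c then 2 * m else 0)"
  assume "\<not> ?thesis"
  then have p: "m / 8 < mass \<nu> {x. x \<ge> c + 5/2 * t}"
    by (simp add: m_def c_def power_divide)
  have m0: "0 < m" using t by (simp add: m_def)
  have supp\<rho>: "supp \<rho> = {c}" using m0 by (auto simp: supp_def \<rho>_def)
  have "spread_within 0 (2 * m) c \<rho>"
    using m0 by (auto simp: spread_within_def distribution_def supp\<rho> integ_def) (auto simp: \<rho>_def)
  moreover have "dominates (r + 1/2) m \<rho> \<mu>"
    using init r by (auto simp: dominates_def pot_def integ_def supp\<rho> tail_eq_0[of 0] simp flip: c_def)
      (auto simp: \<rho>_def tail_eq_0[of 0] c_def)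
  ultimately obtain \<rho>' N where dom: "dominates c m \<rho>' \<nu>" and sp: "spread_within N (2 * m) c \<rho>'"
    and N: "N \<le> 0 + 2 * length (filter (\<lambda>v. center v > r) vs)"
    using dominates_states[OF valid mass[folded m_def] _ _ \<nu>] unfolding c_def by blast
  define V where "V = integ \<rho>' (\<lambda>x. (x - c)\<^sup>2)"
  have "2 * mass \<nu> {x. x \<ge> c + 5/2 * t} * (5/2 * t)\<^sup>2 \<le> V"
    unfolding V_def
    by (rule second_moment_ge[where \<nu> = \<nu> and m = m]) (use sp dom valid \<nu> t in \<open>auto simp: spread_within_def valid_sequence_def\<close>)
  moreover have "2 * (m / 8) * (5/2 * t)\<^sup>2 \<le> 2 * mass \<nu> {x. x \<ge> c + 5/2 * t} * (5/2 * t)\<^sup>2"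
    using p by (intro mult_right_mono) auto
  ultimately have "25/16 * t ^ 5 \<le> V"
    by (simp add: m_def power2_eq_square eval_nat_numeral algebra_simps)
  then have "(25/16 * t ^ 5) ^ 3 \<le> V ^ 3" using t by (intro power_mono) auto
  then have "9 * (25/16 * t ^ 5) ^ 3 \<le> 9 * V ^ 3" by simp
  also have "\<dots> \<le> (real N)\<^sup>2 * (2 * m) ^ 3"
    unfolding V_def using sp m0 by (intro second_moment_le) auto
  also have "\<dots> \<le> (2 * m)\<^sup>2 * (2 * m) ^ 3"
    using N count m0 by (intro mult_right_mono power_mono) (auto simp: m_def)
  also have "\<dots> = 32 * t ^ 15"
    by (simp add: m_def power_mult_distrib power_mult[symmetric] power_add[symmetric])
  finally have "9 * (25/16) ^ 3 * t ^ 15 \<le> 32 * t ^ 15"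
    by (simp add: power_mult_distrib power_mult[symmetric] power_divide)
  then show False using t by (simp add: power_divide)
qed

text \<open>One round of \<open>mass_drop\<close> shifts \<open>r\<close> by
  \<open>1/2 + 5/2 * t\<close> and halves \<open>t\<close>; for \<open>t \<ge> 1\<close> this is
  absorbed, as \<open>1/2 + 5/2 * t + (6 * (t / 2) - 1) \<le> 6 * t - 1\<close>. The exponent
  \<open>j\<close> bounds the number of rounds.\<close>

lemma reach_bound:
  assumes valid: "valid_sequence \<mu> vs" and wc: "weight_constrained \<mu> vs" and init: "\<forall>x>0. \<mu> x = 0"
    and "0 \<le> r" "1 \<le> t" "t < 2 ^ j"
    and "\<forall>\<nu>\<in>set (states \<mu> vs). mass \<nu> {x. x > r} \<le> t ^ 3"
    and "\<nu> \<in> set (states \<mu> vs)" "r + 6 * t - 1 \<le> x"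
  shows "\<nu> x = 0"
  using assms(4-)
proof (induction j arbitrary: r t)
  case 0
  then show ?case by simp
next
  case (Suc j)
  have ne: "states \<mu> vs \<noteq> []" by (cases vs) auto
  have count: "real (length (filter (\<lambda>v. center v > r) vs)) \<le> m"
    if "\<forall>\<nu>\<in>set (states \<mu> vs). mass \<nu> {x. x > r} \<le> m" for r m
  proof -
    have "mu_max \<mu> vs {x. x > r} \<le> m" using that ne by (auto simp: mu_max_def)
    then show ?thesis using wc by (auto simp: weight_constrained_def intro: order_trans)
  qed
  define q where "q = r + 1/2 + 5/2 * t"
  have drop: "\<forall>\<nu>\<in>set (states \<mu> vs). mass \<nu> {x. x > q} \<le> (t / 2) ^ 3"
  proof
    fix \<nu> assume \<nu>: "\<nu> \<in> set (states \<mu> vs)"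
    then have "distribution \<nu>" using valid by (auto simp: valid_sequence_def)
    then have "mass \<nu> {x. x > q} \<le> mass \<nu> {x. x \<ge> q}" by (rule mass_mono) auto
    also have "\<dots> \<le> (t / 2) ^ 3"
      unfolding q_def using Suc.prems \<nu> by (intro mass_drop[OF valid init] count) auto
    finally show "mass \<nu> {x. x > q} \<le> (t / 2) ^ 3" .
  qed
  show ?case
  proof (cases "1 \<le> t / 2")
    case True
    show ?thesis
      by (rule Suc.IH[OF _ True _ drop Suc.prems(5)]) (use Suc.prems in \<open>auto simp: q_def\<close>)
  next
    case False
    \<comment> \<open>The number of moves centered beyond \<open>q\<close> is now a natural number
      below 1, so no mass passes \<open>q + 1/2\<close>, which is less than
      \<open>r + 6 * t - 1\<close>.\<close>
    then have "(t / 2) ^ 3 < 1" using Suc.prems by (intro power_less_one_iff[THEN iffD2]) auto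
    then have "length (filter (\<lambda>v. center v > q) vs) = 0" using count[OF drop] by linarith
    then have "\<forall>v\<in>set vs. is_move v \<and> center v \<le> q"
      using valid by (auto simp: valid_sequence_def filter_empty_conv not_less)
    then show ?thesis
      by (rule states_eq_0[OF Suc.prems(5)]) (use Suc.prems init in \<open>auto simp: q_def\<close>)
  qed
qed

theorem mainTheorem2:
  fixes n :: real and \<mu> \<nu> :: "real \<Rightarrow> real"
  assumes "n \<ge> 1"
    and "distribution \<mu>"
    and "mass \<mu> {x. x \<le> 0} \<le> n"
    and "mass \<mu> {x. x > 0} = 0"
    and "obtained_wc \<mu> \<nu>"
  shows "mass \<nu> {x. x \<ge> 6 * n powr (1/3) - 1} = 0"
proof -
  obtain vs where valid: "valid_sequence \<mu> vs" and wc: "weight_constrained \<mu> vs"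
    and last: "last (states \<mu> vs) = \<nu>"
    using assms(5) by (auto simp: obtained_wc_def)
  have "states \<mu> vs \<noteq> []" by (cases vs) auto
  then have \<nu>: "\<nu> \<in> set (states \<mu> vs)" using last by auto
  then have dist: "distribution \<nu>" using valid by (auto simp: valid_sequence_def)
  define t where "t = n powr (1/3)"
  have t3: "t ^ 3 = n" using assms(1) by (simp add: t_def powr_power)
  have t1: "1 \<le> t" using assms(1) by (simp add: t_def ge_one_powr_ge_zero)
  have init: "\<forall>x>0. \<mu> x = 0" using assms(4) mass_eq_0_iff[OF assms(2)] by auto
  have fin: "finite (supp \<mu>)" using assms(2) by (simp add: distribution_def)
  have "integ \<mu> (\<lambda>x. 1) = integ \<mu> (\<lambda>x. indicator {x. x \<le> 0} x + indicator {x. x > 0} x)"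
    by (rule arg_cong[where f = "integ \<mu>"]) (auto simp: indicator_def)
  also have "\<dots> \<le> n"
    using assms(3,4) fin by (simp add: integ_add mass_eq_integ)
  finally have tot: "integ \<mu> (\<lambda>x. 1) \<le> n" .
  \<comment> \<open>Moves conserve the total mass, which is at most \<open>n\<close> initially; this
    starts the iteration at \<open>r = 0\<close>.\<close>
  have mass: "\<forall>\<nu>\<in>set (states \<mu> vs). mass \<nu> {x. x > 0} \<le> t ^ 3"
  proof
    fix \<nu> assume \<nu>: "\<nu> \<in> set (states \<mu> vs)"
    then have d: "distribution \<nu>" using valid by (auto simp: valid_sequence_def)
    have "mass \<nu> {x. x > 0} \<le> integ \<nu> (\<lambda>x. 1)"
      using d by (auto simp: mass_eq_integ distribution_def indicator_def intro!: integ_mono)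
    also have "\<dots> = integ \<mu> (\<lambda>x. 1)"
      using \<nu> valid fin by (intro integ_one_states) (auto simp: valid_sequence_def)
    finally show "mass \<nu> {x. x > 0} \<le> t ^ 3" using tot t3 by simp
  qed
  obtain j where "t < 2 ^ j" using real_arch_pow[of 2 t] by auto
  then have "\<nu> x = 0" if "6 * t - 1 \<le> x" for x
    using reach_bound[OF valid wc init order_refl t1 _ mass \<nu>, of j x] that by simp
  then show ?thesis using mass_eq_0_iff[OF dist] by (auto simp: t_def)
qed

end
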